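(* Let $p,q\ge1$ be integers and let $F$ be a linear self map of $D_{p,q}$. Suppose there is no projective line contained in $\partial D_{p,q}$ on which every point is fixed by $F$. (1) If $p\le q$ and $F$ has at least $2p+1$ fixed points on $\partial D_{p,q}$, then $F$ has a fixed point in $D_{p,q}$. Furthermore, there is a projective line in $\mathbb P^{p+q-1}$ on which every point is fixed by $F$. (2) If $p>q$ and $F$ has at least $2q$ fixed points on $\partial D_{p,q}$, then $F$ has a fixed point in $D_{p,q}$.
   Context: $H_{p,q}=\begin{pmatrix}I_p&0\\0&-I_q\end{pmatrix}$ and $\cdot^H$ is the Hermitian (conjugate) transpose. The generalized ball is $D_{p,q}=\{[z]\in\mathbb P^{p+q-1}: z^HH_{p,q}z>0\}$, with boundary $\partial D_{p,q}=\{[z]: z^HH_{p,q}z=0\}$. A linear self map of $D_{p,q}$ is a map $D_{p,q}\to D_{p,q}$ of the form $[z]\mapsto[Az]$ for some complex $(p+q)\times(p+q)$ matrix $A$ (not necessarily invertible; well-definedness requires $Az\ne0$ whenever $z^HH_{p,q}z>0$); $A$ is called a matrix representation of the map. The map is also considered, by the same formula, at points $[z]\in\mathbb P^{p+q-1}$ outside $D_{p,q}$ with $Az\neq0$. Its fixed points (in $D_{p,q}$, on $\partial D_{p,q}$, or elsewhere in $\mathbb P^{p+q-1}$) are the points $[v]$ where $v$ is an eigenvector of $A$ associated to a non-zero eigenvalue. *)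

theory Defs
  imports "HOL-Analysis.Analysis"
begin

text \<open>
  The integers \<open>p, q \<ge> 1\<close> are the cardinalities of two finite index types \<open>'p\<close> and \<open>'q\<close> (types are
  nonempty, so positivity is automatic), and \<open>\<complex>\<^sup>p\<^sup>+\<^sup>q\<close> is \<^typ>\<open>complex ^ ('p + 'q)\<close>.
  A point of the projective space is a one-dimensional linear subspace, represented as the set
  of its vectors.
\<close>

definition proj_point :: "complex ^ 'n::finite \<Rightarrow> (complex ^ 'n) set" where
  "proj_point z = vec.span {z}"

definition proj_line :: "(complex ^ 'n::finite) set set \<Rightarrow> bool" where
  "proj_line L \<longleftrightarrow>
     (\<exists>W. vec.subspace W \<and> vec.dim W = 2 \<and> L = {proj_point z | z. z \<in> W \<and> z \<noteq> 0})"

definition H_mat :: "complex ^ ('p::finite + 'q::finite) ^ ('p + 'q)" where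
  "H_mat = (\<chi> i j. if i = j then (case i of Inl _ \<Rightarrow> 1 | Inr _ \<Rightarrow> - 1) else 0)"

text \<open>The value \<open>z\<^sup>H H z\<close>; it is real by \<open>herm_H_eq\<close> below, so that its sign is the sign of its
  real part.\<close>

definition herm_H :: "complex ^ ('p::finite + 'q::finite) \<Rightarrow> complex" where
  "herm_H z = (\<Sum>i\<in>UNIV. cnj (z $ i) * (H_mat *v z) $ i)"

definition gen_ball :: "(complex ^ ('p::finite + 'q::finite)) set set" where
  "gen_ball = {proj_point z | z. z \<noteq> 0 \<and> Re (herm_H z) > 0}"

definition gen_ball_boundary :: "(complex ^ ('p::finite + 'q::finite)) set set" where
  "gen_ball_boundary = {proj_point z | z. z \<noteq> 0 \<and> herm_H z = 0}"

text \<open>Only the values of \<open>F\<close> on the generalized ball are relevant.\<close>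

definition matrix_representation ::
  "complex ^ ('p::finite + 'q::finite) ^ ('p + 'q) \<Rightarrow>
   ((complex ^ ('p + 'q)) set \<Rightarrow> (complex ^ ('p + 'q)) set) \<Rightarrow> bool" where
  "matrix_representation A F \<longleftrightarrow>
     (\<forall>z. Re (herm_H z) > 0 \<longrightarrow> A *v z \<noteq> 0 \<and> F (proj_point z) = proj_point (A *v z))"

definition linear_self_map ::
  "((complex ^ ('p::finite + 'q::finite)) set \<Rightarrow> (complex ^ ('p + 'q)) set) \<Rightarrow> bool" where
  "linear_self_map F \<longleftrightarrow> F \<in> gen_ball \<rightarrow> gen_ball \<and> (\<exists>A. matrix_representation A F)"

definition eigenvector :: "complex ^ 'n::finite ^ 'n \<Rightarrow> complex ^ 'n \<Rightarrow> complex \<Rightarrow> bool" where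
  "eigenvector A v c \<longleftrightarrow> v \<noteq> 0 \<and> A *v v = c *s v"

text \<open>The fixed points, in the whole projective space, of \<open>[z] \<mapsto> [A z]\<close>; a point \<open>[v]\<close> with \<open>A v = 0\<close>,
  where the formula is undefined, is not one of them (see \<open>fixed_points_iff\<close>).\<close>

definition fixed_points :: "complex ^ 'n::finite ^ 'n \<Rightarrow> (complex ^ 'n) set set" where
  "fixed_points A = {proj_point v | v. \<exists>c. c \<noteq> 0 \<and> eigenvector A v c}"

lemma mem_proj_point_iff: "x \<in> proj_point z \<longleftrightarrow> (\<exists>c. x = c *s z)"
  by (auto simp: proj_point_def vec.span_singleton)

lemma proj_point_eq_iff:
  assumes "v \<noteq> 0" "w \<noteq> 0"
  shows "proj_point v = proj_point w \<longleftrightarrow> (\<exists>c. c \<noteq> 0 \<and> v = c *s w)"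
proof
  assume "proj_point v = proj_point w"
  moreover have "v \<in> proj_point v"
    by (simp add: proj_point_def vec.span_base)
  ultimately obtain c where "v = c *s w"
    by (auto simp: mem_proj_point_iff)
  then show "\<exists>c. c \<noteq> 0 \<and> v = c *s w"
    using assms by (metis vec.scale_zero_left)
next
  assume "\<exists>c. c \<noteq> 0 \<and> v = c *s w"
  then obtain c where c: "c \<noteq> 0" "v = c *s w" by blast
  have "w = inverse c *s v" using c by simp
  then show "proj_point v = proj_point w"
    unfolding set_eq_iff mem_proj_point_iff using c by (metis vec.scale_scale)
qed

lemma H_mat_mult_nth:
  "(H_mat *v z) $ i = (case i of Inl _ \<Rightarrow> z $ i | Inr _ \<Rightarrow> - (z $ i))"
proof -
  have "(H_mat *v z) $ i =
      (\<Sum>j\<in>UNIV. if j = i then (case i of Inl _ \<Rightarrow> 1 | Inr _ \<Rightarrow> - 1) * z $ j else 0)"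
    unfolding matrix_vector_mult_def H_mat_def vec_lambda_beta by (intro sum.cong) auto
  then show ?thesis by (simp split: sum.split)
qed

lemma herm_H_eq:
  fixes z :: "complex ^ ('p::finite + 'q::finite)"
  shows "herm_H z =
    complex_of_real ((\<Sum>i\<in>UNIV. (cmod (z $ Inl i))\<^sup>2) - (\<Sum>j\<in>UNIV. (cmod (z $ Inr j))\<^sup>2))"
proof -
  have "herm_H z = (\<Sum>i\<in>(UNIV::'p set). cnj (z $ Inl i) * z $ Inl i) -
      (\<Sum>j\<in>(UNIV::'q set). cnj (z $ Inr j) * z $ Inr j)"
    unfolding herm_H_def H_mat_mult_nth UNIV_Plus_UNIV[symmetric]
    by (subst sum.Plus) (auto simp: sum_negf)
  also have "\<dots> = complex_of_real
      ((\<Sum>i\<in>UNIV. (cmod (z $ Inl i))\<^sup>2) - (\<Sum>j\<in>UNIV. (cmod (z $ Inr j))\<^sup>2))"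
    by (simp add: complex_norm_square mult.commute flip: of_real_power)
  finally show ?thesis .
qed

lemma herm_H_scale: "herm_H (c *s z) = complex_of_real ((cmod c)\<^sup>2) * herm_H z"
  by (simp add: herm_H_eq norm_mult power_mult_distrib sum_distrib_left algebra_simps)

lemma proj_point_in_gen_ball_iff:
  assumes "z \<noteq> 0"
  shows "proj_point z \<in> gen_ball \<longleftrightarrow> Re (herm_H z) > 0"
proof
  assume "proj_point z \<in> gen_ball"
  then obtain w where w: "w \<noteq> 0" "Re (herm_H w) > 0" "proj_point z = proj_point w"
    by (auto simp: gen_ball_def)
  then obtain c where "c \<noteq> 0" "z = c *s w"
    using proj_point_eq_iff[OF assms] by blast
  then show "Re (herm_H z) > 0"
    using w by (simp add: herm_H_scale)
qed (use assms in \<open>auto simp: gen_ball_def\<close>)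

lemma proj_point_in_gen_ball_boundary_iff:
  assumes "z \<noteq> 0"
  shows "proj_point z \<in> gen_ball_boundary \<longleftrightarrow> herm_H z = 0"
proof
  assume "proj_point z \<in> gen_ball_boundary"
  then obtain w where w: "w \<noteq> 0" "herm_H w = 0" "proj_point z = proj_point w"
    by (auto simp: gen_ball_boundary_def)
  then obtain c where "c \<noteq> 0" "z = c *s w"
    using proj_point_eq_iff[OF assms] by blast
  then show "herm_H z = 0"
    using w by (simp add: herm_H_scale)
qed (use assms in \<open>auto simp: gen_ball_boundary_def\<close>)

lemma fixed_points_iff:
  assumes "v \<noteq> 0"
  shows "proj_point v \<in> fixed_points A \<longleftrightarrow> A *v v \<noteq> 0 \<and> proj_point (A *v v) = proj_point v"
proof
  assume "proj_point v \<in> fixed_points A"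
  then obtain w c where w: "c \<noteq> 0" "w \<noteq> 0" "A *v w = c *s w" "proj_point v = proj_point w"
    by (auto simp: fixed_points_def eigenvector_def)
  then obtain d where "d \<noteq> 0" "v = d *s w"
    using proj_point_eq_iff[OF assms] by blast
  then have "A *v v = c *s v"
    using w by (simp add: vector_scalar_commute vector_smult_assoc mult.commute)
  then show "A *v v \<noteq> 0 \<and> proj_point (A *v v) = proj_point v"
    using assms w(1) by (auto simp: proj_point_eq_iff)
next
  assume "A *v v \<noteq> 0 \<and> proj_point (A *v v) = proj_point v"
  then show "proj_point v \<in> fixed_points A"
    using assms by (auto simp: proj_point_eq_iff fixed_points_def eigenvector_def)
qed

lemma fixed_point_in_gen_ball_iff:
  assumes "matrix_representation A F" "X \<in> gen_ball"
  shows "X \<in> fixed_points A \<longleftrightarrow> F X = X"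
proof -
  obtain z where z: "z \<noteq> 0" "Re (herm_H z) > 0" "X = proj_point z"
    using assms(2) by (auto simp: gen_ball_def)
  then show ?thesis
    using assms(1) by (auto simp: fixed_points_iff matrix_representation_def)
qed

end

(*
  Let <u, v> be the Hermitian form of signature (p, q).  If v is a null eigenvector of A, then
  perturbing v to v + t w with Re <v, w> > 0 and small t > 0 gives a positive vector, hence
  Re <A v, A w> >= 0; this forces <v, A w> = mu <v, w> for some constant mu.  So <v, w> is
  nonzero only for those eigenvectors w whose eigenvalue is mu.

  Two boundary fixed points with the same eigenvalue span a line of fixed points; as the line is
  not contained in the boundary, the form is indefinite on it, and it meets the ball.  Otherwise
  the m null eigenvectors have distinct eigenvalues, are independent, and each pairs nontrivially
  with at most one other.  Choosing one vector from each pair, and every unpaired vector, yields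
  an isotropic subspace of dimension at least m / 2, so m <= 2 min p q.  If p > q and m = 2 q, all
  vectors are paired; their orthogonal complement is nonzero, A-invariant and positive definite,
  and an eigenvector of A in it is a fixed point in the ball.
*)
theory Submission
  imports Defs "HOL-Computational_Algebra.Fundamental_Theorem_Algebra"
begin

section \<open>Eigenvectors\<close>

text \<open>Applying \<open>A - ev x\<close> to a vanishing combination kills the term of
  \<open>x\<close> and multiplies every other coefficient by the nonzero number
  \<open>ev v - ev x\<close>. The coefficients change, so the induction runs over all of them at
  once.\<close>

lemma independent_eigenvectors:
  fixes V :: "(complex ^ 'n::finite) set"
  assumes "finite V" "\<And>v. v \<in> V \<Longrightarrow> eigenvector A v (ev v)" "inj_on ev V"
  shows "vec.independent V"
proof -
  have "\<forall>v\<in>V. a v = 0" if "(\<Sum>v\<in>V. a v *s v) = 0" for a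
    using assms that
  proof (induction V arbitrary: a rule: finite_induct)
    case (insert x V)
    have ev: "A *v v = ev v *s v" "v \<noteq> 0" if "v \<in> insert x V" for v
      using insert.prems(1)[OF that] by (auto simp: eigenvector_def)
    have "(\<Sum>v\<in>insert x V. (a v * (ev v - ev x)) *s v) =
        A *v (\<Sum>v\<in>insert x V. a v *s v) - ev x *s (\<Sum>v\<in>insert x V. a v *s v)"
      by (simp add: vec.sum vec.scale ev vec.scale_sum_right vec.scale_left_diff_distrib
          sum_subtractf right_diff_distrib mult.commute vec.add vec.scale_right_distrib)
    also have "\<dots> = 0"
      unfolding insert.prems(3) by simp
    finally have "(\<Sum>v\<in>V. (a v * (ev v - ev x)) *s v) = 0"
      using insert.hyps by simp
    moreover have "inj_on ev V"
      using insert.prems(2) by simp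
    ultimately have "\<forall>v\<in>V. a v * (ev v - ev x) = 0"
      using insert.IH[of "\<lambda>v. a v * (ev v - ev x)"] insert.prems(1) by blast
    moreover have "ev v \<noteq> ev x" if "v \<in> V" for v
      using insert.prems(2) insert.hyps(2) that by (metis inj_onD insertCI)
    ultimately have V: "\<forall>v\<in>V. a v = 0"
      by simp
    then have "a x *s x = 0"
      using insert.prems(3) insert.hyps by simp
    with V ev(2)[of x] show ?case
      by simp
  qed simp
  then show ?thesis
    using assms(1) by (intro vec.independent_if_scalars_zero) auto
qed

section \<open>Eigenvectors inside invariant subspaces\<close>

text \<open>Horner's scheme for \<open>p(A) w\<close>.\<close>

definition poly_act :: "complex ^ 'n::finite ^ 'n \<Rightarrow> complex ^ 'n \<Rightarrow> complex poly \<Rightarrow> complex ^ 'n" where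
  "poly_act A w p = fold_coeffs (\<lambda>c x. c *s w + A *v x) p 0"

lemma poly_act_0 [simp]: "poly_act A w 0 = 0"
  by (simp add: poly_act_def)

lemma poly_act_pCons [simp]: "poly_act A w (pCons c p) = c *s w + A *v poly_act A w p"
  by (cases "p = 0"; cases "c = 0") (simp_all add: poly_act_def)

lemma poly_act_add: "poly_act A w (p + q) = poly_act A w p + poly_act A w q"
proof (induction p arbitrary: q)
  case (pCons a p)
  then show ?case
    by (cases q) (simp add: vec.add vec.scale_left_distrib)
qed simp

lemma poly_act_smult: "poly_act A w (smult c p) = c *s poly_act A w p"
  by (induction p) (simp_all add: vec.scale_right_distrib vec.scale)

lemma poly_act_sum: "poly_act A w (\<Sum>i\<in>I. f i) = (\<Sum>i\<in>I. poly_act A w (f i))"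
  by (induction I rule: infinite_finite_induct) (simp_all add: poly_act_add)

lemma poly_act_monom: "poly_act A w (monom c i) = c *s (((*v) A) ^^ i) w"
  by (induction i) (simp_all add: monom_0 monom_Suc vec.scale)

lemma poly_act_in_subspace:
  assumes "vec.subspace W" "\<And>x. x \<in> W \<Longrightarrow> A *v x \<in> W" "w \<in> W"
  shows "poly_act A w p \<in> W"
  by (induction p) (use assms in \<open>auto simp: vec.subspace_0 vec.subspace_add vec.subspace_scale\<close>)

text \<open>The \<open>N + 1\<close> vectors w, A w, ..., A^N w live in dimension \<open>N\<close>,
  so some nontrivial relation among them exists; its coefficients form the polynomial.\<close>

lemma poly_act_annihilator_exists: "\<exists>p. p \<noteq> 0 \<and> poly_act A w p = 0"
  for A :: "complex ^ 'n::finite ^ 'n"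
proof -
  define g where "g i = (((*v) A) ^^ i) w" for i
  define N where "N = CARD('n)"
  show ?thesis
  \<comment> \<open>Dependence is a property of sets, so a repeated vector in the family would go
    unnoticed. A repetition is handled apart: it gives a difference of two monomials.\<close>
  proof (cases "inj_on g {..N}")
    case True
    then have "card (g ` {..N}) > vec.dim (g ` {..N})"
      using dim_subset_UNIV_cart_gen[of "g ` {..N}"]
      by (simp add: card_image N_def less_Suc_eq_le)
    then have "vec.dependent (g ` {..N})"
      using vec.independent_bound_general vec.dim_eq_card_independent by force
    then obtain u x where u: "(\<Sum>v\<in>g ` {..N}. u v *s v) = 0" "x \<in> {..N}" "u (g x) \<noteq> 0"
      by (auto simp: vec.dependent_finite)
    define p where "p = (\<Sum>i\<le>N. monom (u (g i)) i)"
    have "coeff p x \<noteq> 0"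
      using u(2,3) by (simp add: p_def coeff_sum)
    then have "p \<noteq> 0"
      by auto
    moreover have "poly_act A w p = 0"
      using u(1) True
      by (simp add: p_def poly_act_sum poly_act_monom sum.reindex flip: g_def)
    ultimately show ?thesis
      by blast
  next
    case False
    then obtain i j where ij: "i \<noteq> j" "g i = g j"
      by (auto simp: inj_on_def)
    define p :: "complex poly" where "p = monom 1 i + smult (- 1) (monom 1 j)"
    have "coeff p i = 1"
      using ij(1) by (simp add: p_def)
    then have "p \<noteq> 0"
      by auto
    moreover have "poly_act A w p = 0"
      using ij(2) unfolding p_def poly_act_add poly_act_smult poly_act_monom
      by (simp flip: g_def)
    ultimately show ?thesis
      by blast
  qed
qed

text \<open>Take an annihilating polynomial of \<open>w\<close> of least degree and split off a
  linear factor X - a, leaving \<open>r\<close>. By minimality r(A) w is nonzero, and A - a kills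
  it; invariance keeps it in \<open>W\<close>.\<close>

lemma eigenvector_in_invariant_subspace:
  fixes A :: "complex ^ 'n::finite ^ 'n"
  assumes "vec.subspace W" "\<And>x. x \<in> W \<Longrightarrow> A *v x \<in> W" "w \<in> W" "w \<noteq> 0"
  shows "\<exists>x c. x \<in> W \<and> eigenvector A x c"
proof -
  obtain p where p: "p \<noteq> 0" "poly_act A w p = 0"
    and min: "\<And>r. r \<noteq> 0 \<Longrightarrow> poly_act A w r = 0 \<Longrightarrow> degree p \<le> degree r"
    using ex_has_least_nat[of "\<lambda>p. p \<noteq> 0 \<and> poly_act A w p = 0" _ degree]
      poly_act_annihilator_exists[of A w] by metis
  have "degree p \<noteq> 0"
  proof
    assume "degree p = 0"
    then obtain c where "p = [:c:]"
      by (rule degree_eq_zeroE)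
    with p assms(4) show False
      by simp
  qed
  then obtain a where "poly p a = 0"
    using fundamental_theorem_of_algebra[of p] constant_degree[of p] by auto
  then obtain r where r: "p = [:- a, 1:] * r"
    by (metis dvdE poly_eq_0_iff_dvd)
  with p have "r \<noteq> 0"
    by auto
  moreover have "degree p = Suc (degree r)"
    using \<open>r \<noteq> 0\<close> unfolding r by (subst degree_mult_eq) auto
  ultimately have "poly_act A w r \<noteq> 0"
    using min[of r] by auto
  moreover have "poly_act A w p = (- a) *s poly_act A w r + A *v poly_act A w r"
  proof -
    \<comment> \<open>\<open>pCons 0 r\<close> is X times \<open>r\<close>, which
      \<open>poly_act\<close> turns into one application of \<open>A\<close>.\<close>
    have "p = smult (- a) r + pCons 0 r"
      by (simp add: r)
    then show ?thesis
      by (simp only: poly_act_add poly_act_smult poly_act_pCons vec.scale_zero_left add_0_left)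
  qed
  then have "A *v poly_act A w r = a *s poly_act A w r"
    using p(2) by simp
  ultimately show ?thesis
    using poly_act_in_subspace[of W A w r] assms by (auto simp: eigenvector_def)
qed

text \<open>Serves to bound the dimension of semidefinite subspaces, with \<open>f\<close> a
  projection onto a block of coordinates.\<close>

lemma independent_card_le_of_injective:
  fixes f :: "complex ^ 'n::finite \<Rightarrow> complex ^ 'm::finite"
  assumes "vec.independent T" "Vector_Spaces.linear (*s) (*s) f"
    and "\<And>x. x \<in> vec.span T \<Longrightarrow> f x = 0 \<Longrightarrow> x = 0"
  shows "card T \<le> CARD('m)"
proof -
  interpret f: Vector_Spaces.linear "(*s)" "(*s)" f
    by fact
  have inj: "inj_on f (vec.span T)"
    unfolding f.inj_on_iff_eq_0[OF vec.subspace_span] using assms(3) by blast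
  then have "vec.independent (f ` T)"
    using f.independent_injective_image[OF assms(1)] by blast
  then have "card (f ` T) \<le> CARD('m)"
    using vec.independent_bound_general dim_subset_UNIV_cart_gen order_trans by blast
  moreover have "inj_on f T"
    using inj vec.span_superset by (rule inj_on_subset)
  ultimately show ?thesis
    by (simp add: card_image)
qed

section \<open>The indefinite Hermitian form\<close>

definition hform :: "complex ^ ('p::finite + 'q::finite) \<Rightarrow> complex ^ ('p + 'q) \<Rightarrow> complex" where
  "hform u v = (\<Sum>i\<in>UNIV. cnj (u $ i) * (H_mat *v v) $ i)"

lemma herm_H_eq_hform: "herm_H z = hform z z"
  by (simp add: herm_H_def hform_def)

lemma hform_eq:
  fixes u :: "complex ^ ('p::finite + 'q::finite)"
  shows "hform u v = (\<Sum>i\<in>UNIV. cnj (u $ Inl i) * v $ Inl i) - (\<Sum>j\<in>UNIV. cnj (u $ Inr j) * v $ Inr j)"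
  unfolding hform_def H_mat_mult_nth UNIV_Plus_UNIV[symmetric]
  by (subst sum.Plus) (auto simp: sum_negf)

lemma hform_add_right: "hform u (v + w) = hform u v + hform u w"
  by (simp add: hform_eq algebra_simps sum.distrib)

lemma hform_add_left: "hform (u + v) w = hform u w + hform v w"
  by (simp add: hform_eq algebra_simps sum.distrib)

lemma hform_scale_right: "hform u (c *s v) = c * hform u v"
  by (simp add: hform_eq algebra_simps sum_distrib_left)

lemma hform_scale_left: "hform (c *s u) v = cnj c * hform u v"
  by (simp add: hform_eq algebra_simps sum_distrib_left)

lemma hform_zero_right [simp]: "hform u 0 = 0"
  by (simp add: hform_eq)

lemma hform_sum_right: "hform u (\<Sum>i\<in>I. f i) = (\<Sum>i\<in>I. hform u (f i))"
  by (induction I rule: infinite_finite_induct) (simp_all add: hform_add_right)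

lemma hform_commute: "hform v u = cnj (hform u v)"
  by (simp add: hform_eq mult.commute)

lemma herm_H_add: "Re (herm_H (u + v)) = Re (herm_H u) + 2 * Re (hform u v) + Re (herm_H v)"
  using hform_commute[of v u] by (simp add: herm_H_eq_hform hform_add_left hform_add_right)

lemma hform_nondegenerate:
  assumes "u \<noteq> 0"
  shows "\<exists>w. hform u w = 1"
proof -
  \<comment> \<open>\<open>H_mat\<close> is its own inverse, so pairing \<open>u\<close> with
    \<open>H_mat *v u\<close> gives the squared Euclidean norm of \<open>u\<close>.\<close>
  define w where "w = H_mat *v u"
  have "hform u w = complex_of_real ((\<Sum>i\<in>UNIV. (cmod (u $ Inl i))\<^sup>2) + (\<Sum>j\<in>UNIV. (cmod (u $ Inr j))\<^sup>2))"
    unfolding hform_eq w_def H_mat_mult_nth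
    by (simp add: sum_negf complex_norm_square mult.commute flip: of_real_power)
  moreover obtain i where i: "u $ i \<noteq> 0"
    using assms by (auto simp: vec_eq_iff)
  have "(\<Sum>i\<in>UNIV. (cmod (u $ Inl i))\<^sup>2) + (\<Sum>j\<in>UNIV. (cmod (u $ Inr j))\<^sup>2) \<noteq> 0"
    using i by (cases i)
      (simp_all add: add_nonneg_eq_0_iff sum_nonneg sum_nonneg_eq_0_iff del: of_real_sum, blast+)
  ultimately have "hform u w \<noteq> 0"
    by (simp only: of_real_eq_0_iff not_False_eq_True)
  then have "hform u (inverse (hform u w) *s w) = 1"
    by (simp add: hform_scale_right)
  then show ?thesis
    by blast
qed

lemma hform_span_eq_0:
  assumes "w \<in> vec.span V" "\<And>v. v \<in> V \<Longrightarrow> hform u v = 0"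
  shows "hform u w = 0"
  using assms(1)
  by (induction rule: vec.span_induct_alt) (auto simp: hform_add_right hform_scale_right assms(2))

lemma herm_H_span_isotropic:
  assumes "\<And>u v. u \<in> T \<Longrightarrow> v \<in> T \<Longrightarrow> hform u v = 0" "x \<in> vec.span T"
  shows "herm_H x = 0"
proof -
  have "hform u x = 0" if "u \<in> T" for u
    using hform_span_eq_0[OF assms(2)] assms(1) that by blast
  then have "hform x u = 0" if "u \<in> T" for u
    using that hform_commute[of x u] by simp
  then show ?thesis
    using hform_span_eq_0[OF assms(2)] by (simp add: herm_H_eq_hform)
qed

text \<open>If the first block of coordinates of x vanishes, then \<open>herm_H x\<close> is minus a
  sum of squares. Nonnegativity makes x zero, so projecting to that block is injective on the
  span.\<close>

lemma independent_nonneg_card_le: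
  fixes T :: "(complex ^ ('p::finite + 'q::finite)) set"
  assumes "vec.independent T" "\<And>x. x \<in> vec.span T \<Longrightarrow> Re (herm_H x) \<ge> 0"
  shows "card T \<le> CARD('p)"
proof (rule independent_card_le_of_injective[OF assms(1)])
  show "Vector_Spaces.linear (*s) (*s) (\<lambda>z :: complex ^ ('p + 'q). (\<chi> i. z $ Inl i) :: complex ^ 'p)"
    by unfold_locales (auto simp: vec_eq_iff algebra_simps)
  fix x assume x: "x \<in> vec.span T" "((\<chi> i. x $ Inl i) :: complex ^ 'p) = 0"
  then have l: "x $ Inl i = 0" for i
    by (simp add: vec_eq_iff)
  then have "(\<Sum>j\<in>UNIV. (cmod (x $ Inr j))\<^sup>2) \<le> 0"
    using assms(2)[OF x(1)] by (simp add: herm_H_eq)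
  then have "(\<Sum>j\<in>UNIV. (cmod (x $ Inr j))\<^sup>2) = 0"
    by (intro order.antisym sum_nonneg) auto
  then have "x $ Inr j = 0" for j
    by (simp add: sum_nonneg_eq_0_iff)
  with l show "x = 0"
    by (metis vec_eq_iff zero_index sum.exhaust)
qed

lemma independent_nonpos_card_le:
  fixes T :: "(complex ^ ('p::finite + 'q::finite)) set"
  assumes "vec.independent T" "\<And>x. x \<in> vec.span T \<Longrightarrow> Re (herm_H x) \<le> 0"
  shows "card T \<le> CARD('q)"
proof (rule independent_card_le_of_injective[OF assms(1)])
  show "Vector_Spaces.linear (*s) (*s) (\<lambda>z :: complex ^ ('p + 'q). (\<chi> i. z $ Inr i) :: complex ^ 'q)"
    by unfold_locales (auto simp: vec_eq_iff algebra_simps)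
  fix x assume x: "x \<in> vec.span T" "((\<chi> i. x $ Inr i) :: complex ^ 'q) = 0"
  then have r: "x $ Inr i = 0" for i
    by (simp add: vec_eq_iff)
  then have "(\<Sum>j\<in>UNIV. (cmod (x $ Inl j))\<^sup>2) \<le> 0"
    using assms(2)[OF x(1)] by (simp add: herm_H_eq)
  then have "(\<Sum>j\<in>UNIV. (cmod (x $ Inl j))\<^sup>2) = 0"
    by (intro order.antisym sum_nonneg) auto
  then have "x $ Inl j = 0" for j
    by (simp add: sum_nonneg_eq_0_iff)
  with r show "x = 0"
    by (metis vec_eq_iff zero_index sum.exhaust)
qed

text \<open>These are fewer linear equations than unknowns.\<close>

lemma orthogonal_vector_exists:
  fixes V :: "(complex ^ ('p::finite + 'q::finite)) set"
  assumes "finite V" "card V < CARD('p + 'q)"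
  shows "\<exists>w. w \<noteq> 0 \<and> (\<forall>v\<in>V. hform v w = 0)"
proof -
  obtain e :: "_ \<Rightarrow> 'p + 'q" where e: "inj_on e V"
    using assms inj_on_iff_card_le[of V "UNIV :: ('p + 'q) set"] by auto
  have "card (e ` V) < CARD('p + 'q)"
    using assms(2) e by (simp add: card_image)
  then obtain k where k: "k \<notin> e ` V"
    by (metis UNIV_eq_I less_irrefl)
  \<comment> \<open>The equations are packed into an endomorphism by assigning to each vector of
    \<open>V\<close> its own coordinate through \<open>e\<close>. The spare coordinate
    \<open>k\<close> of \<open>L w\<close> is always 0, so \<open>L\<close> is not surjective and
    therefore has a kernel.\<close>
  define L :: "complex ^ ('p + 'q) \<Rightarrow> complex ^ ('p + 'q)"
    where "L w = (\<chi> i. if i \<in> e ` V then hform (inv_into V e i) w else 0)" for w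
  have lin: "Vector_Spaces.linear (*s) (*s) L"
    by unfold_locales
      (auto simp: L_def vec_eq_iff algebra_simps hform_add_right hform_scale_right)
  have "axis k 1 \<noteq> L w" for w
  proof
    assume "axis k 1 = L w"
    then have "axis k 1 $ k = L w $ k"
      by simp
    with k show False
      by (simp add: L_def)
  qed
  then have "\<not> surj L"
    by (metis surjD)
  then have "\<not> inj L"
    using vec.linear_inj_imp_surj[OF lin] by blast
  then obtain w where w: "w \<noteq> 0" "L w = 0"
    using vec.linear_inj_iff_eq_0[OF lin] by blast
  have "hform v w = 0" if "v \<in> V" for v
  proof -
    have "L w $ e v = 0"
      by (simp add: w)
    then show ?thesis
      using that e by (simp add: L_def)
  qed
  with w show ?thesis
    by blast
qed

section \<open>Matrices preserving positivity\<close>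

text \<open>In other words, \<open>v\<close> is also an eigenvector of the adjoint of
  \<open>A\<close> with respect to \<open>hform\<close>. The functional sending w to
  \<open>hform (A *v v) (A *v w)\<close> vanishes on the kernel of \<open>hform v\<close>, so it is
  a multiple of \<open>hform v\<close>; since \<open>c\<close> is nonzero, \<open>A *v v\<close> may
  be replaced by \<open>v\<close> in it.\<close>

lemma adjoint_eigenvector:
  assumes pos: "\<And>z. Re (herm_H z) > 0 \<Longrightarrow> Re (herm_H (A *v z)) > 0"
    and v: "eigenvector A v c" "c \<noteq> 0" "herm_H v = 0"
  shows "\<exists>\<mu>. \<forall>w. hform v (A *v w) = \<mu> * hform v w"
proof -
  have Av: "A *v v = c *s v" and "v \<noteq> 0"
    using v(1) by (auto simp: eigenvector_def)
  have nonneg: "Re (hform (A *v v) (A *v w)) \<ge> 0" if w: "Re (hform v w) > 0" for w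
  proof (rule ccontr)
    assume neg: "\<not> ?thesis"
    have "\<forall>\<^sub>F t in at_right 0. 2 * Re (hform v w) + t * Re (herm_H w) > 0"
      by (rule order_tendstoD(1)[OF _ w[THEN mult_pos_pos[of 2, OF zero_less_numeral]]])
        (auto intro!: tendsto_eq_intros)
    moreover have "\<forall>\<^sub>F t in at_right 0.
        2 * Re (hform (A *v v) (A *v w)) + t * Re (herm_H (A *v w)) < 0"
      by (rule order_tendstoD(2)[where y = "2 * Re (hform (A *v v) (A *v w))"])
        (use neg in \<open>auto intro!: tendsto_eq_intros\<close>)
    moreover have "\<forall>\<^sub>F t :: real in at_right 0. t > 0"
      by (simp add: eventually_at_right_less)
    ultimately have "\<forall>\<^sub>F t :: real in at_right 0. False"
    proof eventually_elim
      case (elim t)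
      \<comment> \<open>Used for v, w and for their images under \<open>A\<close>. As v and
        \<open>A *v v\<close> are null, the sign for small t > 0 is that of the first-order
        coefficient.\<close>
      have h: "Re (herm_H (x + complex_of_real t *s y)) =
          Re (herm_H x) + t * (2 * Re (hform x y) + t * Re (herm_H y))" for x y
        by (simp add: herm_H_add hform_scale_right herm_H_scale power2_eq_square algebra_simps)
      have "Re (herm_H (v + complex_of_real t *s w)) > 0"
        unfolding h using elim v(3) by simp
      then have "Re (herm_H (A *v v + complex_of_real t *s (A *v w))) > 0"
        using pos[of "v + complex_of_real t *s w"] by (simp add: vec.add vec.scale)
      moreover have "herm_H (A *v v) = 0"
        by (simp add: Av herm_H_scale v(3))
      ultimately show False
        unfolding h using elim by (simp add: zero_less_mult_iff)
    qed
    then show False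
      by simp
  qed
  obtain w0 where w0: "hform v w0 = 1"
    using hform_nondegenerate \<open>v \<noteq> 0\<close> by blast
  have ker: "hform (A *v v) (A *v w) = 0" if w: "hform v w = 0" for w
  proof (rule ccontr)
    define \<beta> where "\<beta> = hform (A *v v) (A *v w)"
    define \<alpha> where "\<alpha> = hform (A *v v) (A *v w0)"
    \<comment> \<open>Chosen so that \<open>s * \<beta>\<close> equals
      \<open>- (\<bar>Re \<alpha>\<bar> + 1)\<close>. Moving \<open>w0\<close> by
      \<open>s *s w\<close> keeps its pairing with \<open>v\<close> equal to 1 but makes the image
      pairing negative.\<close>
    define s where "s = - complex_of_real ((\<bar>Re \<alpha>\<bar> + 1) / (cmod \<beta>)\<^sup>2) * cnj \<beta>"
    assume "hform (A *v v) (A *v w) \<noteq> 0"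
    then have "\<beta> \<noteq> 0"
      by (simp add: \<beta>_def)
    have "s * \<beta> = - complex_of_real ((\<bar>Re \<alpha>\<bar> + 1) / (cmod \<beta>)\<^sup>2) * complex_of_real ((cmod \<beta>)\<^sup>2)"
      unfolding s_def complex_norm_square by simp
    also have "\<dots> = complex_of_real (- (\<bar>Re \<alpha>\<bar> + 1))"
      using \<open>\<beta> \<noteq> 0\<close> by (simp flip: of_real_mult of_real_minus)
    finally have "Re (\<alpha> + s * \<beta>) < 0"
      by simp
    moreover have "Re (hform v (w0 + s *s w)) > 0"
      by (simp add: hform_add_right hform_scale_right w w0)
    from nonneg[OF this] have "Re (\<alpha> + s * \<beta>) \<ge> 0"
      by (simp add: hform_add_right hform_scale_right vec.add vec.scale \<alpha>_def \<beta>_def)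
    ultimately show False
      by simp
  qed
  have "hform v (A *v w) = hform v (A *v w0) * hform v w" for w
  proof -
    \<comment> \<open>As \<open>hform v w0 = 1\<close>, this is the component of w in the kernel of
      \<open>hform v\<close>. The constant is thus \<open>hform v (A *v w0)\<close>.\<close>
    have "hform v (w + (- hform v w) *s w0) = 0"
      by (simp only: hform_add_right hform_scale_right w0) simp
    from ker[OF this] have "hform v (A *v (w + (- hform v w) *s w0)) = 0"
      using v(2) by (simp add: Av hform_scale_left)
    then show ?thesis
      by (simp only: vec.add vec.scale hform_add_right hform_scale_right) (simp add: algebra_simps)
  qed
  then show ?thesis
    by blast
qed

lemma linear_self_map_pos:
  assumes "linear_self_map F" "matrix_representation A F" "Re (herm_H z) > 0"
  shows "Re (herm_H (A *v z)) > 0"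
proof -
  have "z \<noteq> 0"
    using assms(3) by (auto simp: herm_H_eq_hform)
  then have "proj_point z \<in> gen_ball"
    using assms(3) by (simp add: proj_point_in_gen_ball_iff)
  then have "F (proj_point z) \<in> gen_ball"
    using assms(1) by (auto simp: linear_self_map_def)
  then show ?thesis
    using assms(2,3) by (auto simp: matrix_representation_def proj_point_in_gen_ball_iff)
qed

section \<open>Fixed points sharing an eigenvalue\<close>

lemma eigenspace_line:
  assumes "v \<noteq> 0" "w \<noteq> 0" "proj_point v \<noteq> proj_point w"
    and "eigenvector A v c" "eigenvector A w c" "c \<noteq> 0"
  shows "proj_line {proj_point z |z. z \<in> vec.span {v, w} \<and> z \<noteq> 0}"
    and "{proj_point z |z. z \<in> vec.span {v, w} \<and> z \<noteq> 0} \<subseteq> fixed_points A"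
proof -
  have "v \<notin> vec.span {w}"
  proof
    assume "v \<in> vec.span {w}"
    then obtain k where "v = k *s w"
      by (auto simp: vec.span_singleton)
    with assms(1-3) show False
      using proj_point_eq_iff[of v w] by auto
  qed
  then have ind: "vec.independent {v, w}" and "v \<noteq> w"
    using assms(2) by (auto simp: vec.independent_insert vec.span_base)
  then have "vec.dim (vec.span {v, w}) = 2"
    by (simp add: vec.dim_span_eq_card_independent del: vec.dim_span)
  then show "proj_line {proj_point z |z. z \<in> vec.span {v, w} \<and> z \<noteq> 0}"
    unfolding proj_line_def using vec.subspace_span by blast
  have "A *v z = c *s z" if "z \<in> vec.span {v, w}" for z
    using that
    by (induction rule: vec.span_induct_alt)
      (use assms in \<open>auto simp: eigenvector_def vec.add vec.scale_right_distrib vec.scale mult.commute\<close>)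
  then show "{proj_point z |z. z \<in> vec.span {v, w} \<and> z \<noteq> 0} \<subseteq> fixed_points A"
    using assms(6) by (auto simp: fixed_points_def eigenvector_def)
qed

lemma equal_eigenvalues_fixed_point:
  fixes A :: "complex ^ ('p::finite + 'q::finite) ^ ('p + 'q)"
  assumes "\<not> (\<exists>L. proj_line L \<and> L \<subseteq> gen_ball_boundary \<and> L \<subseteq> fixed_points A)"
    and vw: "proj_point v \<noteq> proj_point w" "herm_H v = 0" "herm_H w = 0"
    and ev: "eigenvector A v c" "eigenvector A w c" "c \<noteq> 0"
  shows "(\<exists>X. X \<in> gen_ball \<and> X \<in> fixed_points A) \<and> (\<exists>L. proj_line L \<and> L \<subseteq> fixed_points A)"
proof -
  let ?L = "{proj_point z |z. z \<in> vec.span {v, w} \<and> z \<noteq> 0}"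
  have nz: "v \<noteq> 0" "w \<noteq> 0"
    using ev by (auto simp: eigenvector_def)
  note L = eigenspace_line[OF nz vw(1) ev]
  \<comment> \<open>Otherwise the whole span is isotropic, and the line of fixed points lies in the
    boundary, which the first assumption excludes.\<close>
  have "hform v w \<noteq> 0"
  proof
    assume "hform v w = 0"
    then have "hform w v = 0"
      using hform_commute[of w v] by simp
    have "herm_H x = 0" if "x \<in> vec.span {v, w}" for x
      by (rule herm_H_span_isotropic[OF _ that])
        (use \<open>hform v w = 0\<close> \<open>hform w v = 0\<close> vw in \<open>auto simp: herm_H_eq_hform\<close>)
    then have "?L \<subseteq> gen_ball_boundary"
      by (auto simp: gen_ball_boundary_def)
    with L assms(1) show False
      by blast
  qed
  \<comment> \<open>The coefficient turns the cross term into
    \<open>2 * (cmod (hform v w))\<^sup>2\<close>; the two diagonal terms vanish.\<close>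
  define z where "z = v + cnj (hform v w) *s w"
  have "cnj (hform v w) * hform v w = complex_of_real ((cmod (hform v w))\<^sup>2)"
    by (subst complex_norm_square) (rule mult.commute)
  then have "Re (herm_H z) = 2 * (cmod (hform v w))\<^sup>2"
    unfolding z_def herm_H_add hform_scale_right by (simp add: vw herm_H_scale)
  then have "Re (herm_H z) > 0"
    using \<open>hform v w \<noteq> 0\<close> by simp
  moreover from this have "z \<noteq> 0"
    by (auto simp: herm_H_eq_hform)
  moreover have "z \<in> vec.span {v, w}"
    by (simp add: z_def vec.span_add vec.span_scale vec.span_base)
  ultimately have "proj_point z \<in> gen_ball" "proj_point z \<in> ?L"
    by (auto simp: proj_point_in_gen_ball_iff)
  with L show ?thesis
    by blast
qed

section \<open>Null eigenvectors with distinct eigenvalues\<close>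

text \<open>\<open>R\<close> is a graph in which every vertex has at most one neighbour. If
  \<open>T\<close> is a largest independent set, each vertex outside has a neighbour in
  \<open>T\<close>, and different vertices have different ones, so \<open>V - T\<close> injects into
  \<open>T\<close>. When the sizes agree this injection is onto, and every element of
  \<open>T\<close> has a partner.\<close>

lemma matching_independent_set:
  assumes "finite V" "symp_on V R" "\<And>x. x \<in> V \<Longrightarrow> \<not> R x x"
    and uniq: "\<And>x y z. x \<in> V \<Longrightarrow> y \<in> V \<Longrightarrow> z \<in> V \<Longrightarrow> R x y \<Longrightarrow> R x z \<Longrightarrow> y = z"
  obtains T where "T \<subseteq> V" "\<And>x y. x \<in> T \<Longrightarrow> y \<in> T \<Longrightarrow> \<not> R x y" "card V \<le> 2 * card T"
    "\<And>t. card V = 2 * card T \<Longrightarrow> t \<in> T \<Longrightarrow> \<exists>s\<in>V. R s t"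
proof -
  define P where "P T \<longleftrightarrow> T \<subseteq> V \<and> (\<forall>x\<in>T. \<forall>y\<in>T. \<not> R x y)" for T
  have "P {}"
    by (simp add: P_def)
  then obtain T where T: "P T" and max: "\<And>U. P U \<Longrightarrow> card U \<le> card T"
  proof -
    have "\<forall>U. P U \<longrightarrow> card U < Suc (card V)"
      using assms(1) by (simp add: P_def card_mono less_Suc_eq_le)
    with \<open>P {}\<close> show thesis
      using ex_has_greatest_nat[of P "{}" card "Suc (card V)"] that by blast
  qed
  have TV: "T \<subseteq> V" "finite T"
    using T finite_subset[OF _ assms(1)] by (simp_all add: P_def)
  have "\<exists>t\<in>T. R x t" if x: "x \<in> V - T" for x
  proof (rule ccontr)
    assume "\<not> ?thesis"
    then have "\<forall>t\<in>T. \<not> R x t"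
      by blast
    moreover from this have "\<forall>t\<in>T. \<not> R t x"
      using x TV(1) symp_onD[OF assms(2)] by blast
    ultimately have "P (insert x T)"
      using T x assms(3)[of x] by (simp add: P_def)
    with max[of "insert x T"] x TV show False
      by simp
  qed
  then obtain f where f: "\<And>x. x \<in> V - T \<Longrightarrow> f x \<in> T \<and> R x (f x)"
    by metis
  have inj: "inj_on f (V - T)"
  proof (rule inj_onI)
    fix x y assume xy: "x \<in> V - T" "y \<in> V - T" "f x = f y"
    then have "f x \<in> V" "R x (f x)" "R y (f x)"
      using f[of x] f[of y] TV(1) by auto
    then have "R (f x) x" "R (f x) y"
      using symp_onD[OF assms(2)] xy(1,2) by simp_all
    then show "x = y"
      using uniq[of "f x" x y] xy \<open>f x \<in> V\<close> by simp
  qed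
  have sub: "f ` (V - T) \<subseteq> T"
    using f by blast
  have card: "card V = card (V - T) + card T"
    using TV assms(1) by (simp add: card_Diff_subset card_mono)
  have "card (V - T) \<le> card T"
    using card_inj_on_le[OF inj sub TV(2)] .
  then have "card V \<le> 2 * card T"
    using card by simp
  moreover have "\<exists>s\<in>V. R s t" if "card V = 2 * card T" "t \<in> T" for t
  proof -
    have "card (f ` (V - T)) = card T"
      using that(1) card inj by (simp add: card_image)
    then have "t \<in> f ` (V - T)"
      using sub TV(2) that(2) card_subset_eq by blast
    then show ?thesis
      using f by (metis DiffD1 imageE)
  qed
  moreover have "\<not> R x y" if "x \<in> T" "y \<in> T" for x y
    using T that by (simp add: P_def)
  ultimately show thesis
    using that TV(1) by blast
qed

text \<open>The matching lemma is applied to nonvanishing of \<open>hform\<close>. In the extremal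
  case the last conclusion provides for each t a vector of \<open>V\<close> that pairs with t and
  with no other vector of \<open>V\<close>; these act as dual functionals on the span of
  \<open>T\<close>.\<close>

lemma isotropic_half:
  fixes A :: "complex ^ ('p::finite + 'q::finite) ^ ('p + 'q)"
  assumes pos: "\<And>z. Re (herm_H z) > 0 \<Longrightarrow> Re (herm_H (A *v z)) > 0"
    and "finite V"
    and V: "\<And>v. v \<in> V \<Longrightarrow> eigenvector A v (ev v) \<and> ev v \<noteq> 0 \<and> herm_H v = 0"
    and inj: "inj_on ev V"
  obtains T where "T \<subseteq> V" "vec.independent T" "card T \<le> CARD('p)" "card T \<le> CARD('q)"
    "\<And>x y. x \<in> T \<Longrightarrow> y \<in> T \<Longrightarrow> hform x y = 0" "card V \<le> 2 * card T"
    "\<And>t. card V = 2 * card T \<Longrightarrow> t \<in> T \<Longrightarrow>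
      \<exists>s\<in>V. hform s t \<noteq> 0 \<and> (\<forall>t'\<in>V - {t}. hform s t' = 0)"
proof -
  have uniq: "y = z" if xyz: "x \<in> V" "y \<in> V" "z \<in> V" "hform x y \<noteq> 0" "hform x z \<noteq> 0" for x y z
  proof -
    obtain \<mu> where \<mu>: "\<And>w. hform x (A *v w) = \<mu> * hform x w"
      using adjoint_eigenvector[OF pos] V[OF xyz(1)] by blast
    \<comment> \<open>Compute \<open>hform x (A *v w)\<close> twice, once with \<open>A\<close>
      acting on w and once through \<open>x\<close>.\<close>
    have "ev w = \<mu>" if "w \<in> V" "hform x w \<noteq> 0" for w
      using \<mu>[of w] V[OF that(1)] that(2) by (simp add: eigenvector_def hform_scale_right)
    then show ?thesis
      using xyz inj by (metis inj_onD)
  qed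
  have "symp_on V (\<lambda>x y. hform x y \<noteq> 0)"
    by (rule symp_onI) (metis hform_commute complex_cnj_zero_iff)
  moreover have "\<not> hform x x \<noteq> 0" if "x \<in> V" for x
    using V[OF that] by (simp add: herm_H_eq_hform)
  ultimately obtain T where T: "T \<subseteq> V" "\<And>x y. x \<in> T \<Longrightarrow> y \<in> T \<Longrightarrow> \<not> hform x y \<noteq> 0"
      and half: "card V \<le> 2 * card T"
      and partner: "\<And>t. card V = 2 * card T \<Longrightarrow> t \<in> T \<Longrightarrow> \<exists>s\<in>V. hform s t \<noteq> 0"
    using uniq by (rule matching_independent_set[OF assms(2), where R = "\<lambda>x y. hform x y \<noteq> 0"]) simp_all
  have "vec.independent V"
    using independent_eigenvectors[OF assms(2) _ inj] V by blast
  then have ind: "vec.independent T"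
    using T(1) by (rule vec.independent_mono)
  have iso: "hform x y = 0" if "x \<in> T" "y \<in> T" for x y
    using T(2)[OF that] by simp
  have "herm_H x = 0" if "x \<in> vec.span T" for x
    using iso that by (rule herm_H_span_isotropic)
  then have cards: "card T \<le> CARD('p)" "card T \<le> CARD('q)"
    using independent_nonneg_card_le[OF ind] independent_nonpos_card_le[OF ind] by simp_all
  have dual: "\<exists>s\<in>V. hform s t \<noteq> 0 \<and> (\<forall>t'\<in>V - {t}. hform s t' = 0)"
    if c: "card V = 2 * card T" and t: "t \<in> T" for t
  proof -
    obtain s where s: "s \<in> V" "hform s t \<noteq> 0"
      using partner[OF c t] by blast
    have "t \<in> V"
      using T(1) t by (rule subsetD)
    have "hform s t' = 0" if "t' \<in> V - {t}" for t'
    proof (rule ccontr)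
      assume "hform s t' \<noteq> 0"
      with uniq[of s t t'] s \<open>t \<in> V\<close> that show False
        by simp
    qed
    with s show ?thesis
      by (intro bexI[of _ s]) simp_all
  qed
  show thesis
    by (rule that[OF T(1) ind cards iso half dual])
qed

text \<open>The complement of \<open>V\<close> is invariant because each v in \<open>V\<close> is an
  eigenvector of the adjoint, and it is nonzero by dimension. The eigenvalue found may still be 0
  here.\<close>

lemma orthogonal_complement_eigenvector:
  fixes A :: "complex ^ ('p::finite + 'q::finite) ^ ('p + 'q)"
  assumes pos: "\<And>z. Re (herm_H z) > 0 \<Longrightarrow> Re (herm_H (A *v z)) > 0"
    and V: "finite V" "\<And>v. v \<in> V \<Longrightarrow> \<exists>c. eigenvector A v c \<and> c \<noteq> 0 \<and> herm_H v = 0"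
    and card: "card V < CARD('p + 'q)"
  shows "\<exists>x c. eigenvector A x c \<and> (\<forall>v\<in>V. hform v x = 0)"
proof -
  define W where "W = {w. \<forall>v\<in>V. hform v w = 0}"
  have "vec.subspace W"
    by (rule vec.subspaceI) (auto simp: W_def hform_add_right hform_scale_right)
  moreover have "A *v w \<in> W" if "w \<in> W" for w
    unfolding W_def
  proof safe
    fix v assume "v \<in> V"
    then obtain \<mu> where "hform v (A *v w) = \<mu> * hform v w"
      using adjoint_eigenvector[OF pos] V(2) by blast
    then show "hform v (A *v w) = 0"
      using that \<open>v \<in> V\<close> by (simp add: W_def)
  qed
  moreover obtain w where "w \<in> W" "w \<noteq> 0"
    using orthogonal_vector_exists[OF V(1) card] by (auto simp: W_def)
  ultimately obtain x c where "x \<in> W" "eigenvector A x c"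
    using eigenvector_in_invariant_subspace by blast
  then show ?thesis
    unfolding W_def by blast
qed

text \<open>If \<open>herm_H w\<close> were not positive, then adjoining \<open>w\<close> to
  \<open>T\<close> would span a subspace of dimension q + 1 on which the form is nonpositive, one
  more than the signature allows.\<close>

lemma positive_on_complement:
  fixes T :: "(complex ^ ('p::finite + 'q::finite)) set"
  assumes T: "finite T" "vec.independent T" "card T = CARD('q)" "T \<subseteq> V"
    and isotropic: "\<And>x y. x \<in> T \<Longrightarrow> y \<in> T \<Longrightarrow> hform x y = 0"
    and dual: "\<And>t. t \<in> T \<Longrightarrow> \<exists>s\<in>V. hform s t \<noteq> 0 \<and> (\<forall>t'\<in>V - {t}. hform s t' = 0)"
    and w: "w \<noteq> 0" "\<And>v. v \<in> V \<Longrightarrow> hform v w = 0"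
  shows "Re (herm_H w) > 0"
proof (rule ccontr)
  assume neg: "\<not> ?thesis"
  have "w \<notin> vec.span T"
  proof
    assume "w \<in> vec.span T"
    then obtain a where a: "w = (\<Sum>t\<in>T. a t *s t)"
      using vec.span_finite[OF T(1)] by auto
    have "a t = 0" if t: "t \<in> T" for t
    proof -
      obtain s where s: "s \<in> V" "hform s t \<noteq> 0" "\<forall>t'\<in>V - {t}. hform s t' = 0"
        using dual[OF t] by blast
      have "hform s w = (\<Sum>t'\<in>T. a t' * hform s t')"
        by (simp add: a hform_sum_right hform_scale_right)
      \<comment> \<open>Among the vectors of \<open>T\<close> only \<open>t\<close> pairs with
        \<open>s\<close>, so \<open>s\<close> reads off the coefficient of \<open>t\<close>; but
        \<open>w\<close> is orthogonal to \<open>s\<close>.\<close>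
      also have "\<dots> = (\<Sum>t'\<in>T. if t' = t then a t * hform s t else 0)"
        using s(3) T(4) by (intro sum.cong) auto
      also have "\<dots> = a t * hform s t"
        using t T(1) by simp
      finally show ?thesis
        using w(2)[OF s(1)] s(2) by simp
    qed
    with a w(1) show False
      by simp
  qed
  then have ind: "vec.independent (insert w T)" and "w \<notin> T"
    using T vec.span_base by (auto simp: vec.independent_insert)
  have "Re (herm_H x) \<le> 0" if x: "x \<in> vec.span (insert w T)" for x
  proof -
    obtain k where k: "x - k *s w \<in> vec.span T"
      using x by (auto simp: vec.span_insert)
    \<comment> \<open>\<open>y\<close> is null and orthogonal to \<open>w\<close>, so
      \<open>herm_H x\<close> is \<open>herm_H w\<close> times the squared modulus of
      \<open>k\<close>.\<close>
    define y where "y = x - k *s w"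
    have x_eq: "x = y + k *s w"
      by (simp add: y_def)
    have "hform w y = 0"
    proof (rule hform_span_eq_0[of y T])
      show "y \<in> vec.span T"
        using k by (simp add: y_def)
      show "hform w t = 0" if "t \<in> T" for t
        using w(2)[of t] hform_commute[of w t] that T(4) by auto
    qed
    then have "hform y w = 0"
      using hform_commute[of y w] by simp
    moreover have "herm_H y = 0"
      using herm_H_span_isotropic[OF isotropic k] by (simp add: y_def)
    ultimately show ?thesis
      using neg by (simp add: x_eq herm_H_add hform_scale_right herm_H_scale mult_nonneg_nonpos)
  qed
  with ind have "card (insert w T) \<le> CARD('q)"
    by (rule independent_nonpos_card_le)
  then show False
    using T \<open>w \<notin> T\<close> by simp
qed

section \<open>From boundary fixed points to the theorem\<close>

lemma boundary_fixed_point_representatives: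
  assumes "finite S" "S \<subseteq> fixed_points A \<inter> gen_ball_boundary"
  obtains V ev where "finite V" "card V = card S" "inj_on proj_point V"
    "\<And>v. v \<in> V \<Longrightarrow> eigenvector A v (ev v) \<and> ev v \<noteq> 0 \<and> herm_H v = 0"
proof -
  have "\<exists>v c. X = proj_point v \<and> eigenvector A v c \<and> c \<noteq> 0 \<and> herm_H v = 0" if "X \<in> S" for X
  proof -
    obtain v c where v: "X = proj_point v" "c \<noteq> 0" "eigenvector A v c"
      using \<open>X \<in> S\<close> assms(2) by (auto simp: fixed_points_def)
    moreover have "proj_point v \<in> gen_ball_boundary"
      using v(1) \<open>X \<in> S\<close> assms(2) by auto
    ultimately show ?thesis
      using proj_point_in_gen_ball_boundary_iff[of v] by (auto simp: eigenvector_def)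
  qed
  then obtain rep ev where rep: "\<And>X. X \<in> S \<Longrightarrow> X = proj_point (rep X) \<and> eigenvector A (rep X) (ev X)
      \<and> ev X \<noteq> 0 \<and> herm_H (rep X) = 0"
    by metis
  show thesis
  proof
    show "finite (rep ` S)"
      using assms(1) by simp
    show "card (rep ` S) = card S"
      by (rule card_image) (metis inj_onI rep)
    show "inj_on proj_point (rep ` S)"
      by (rule inj_onI) (metis imageE rep)
    show "eigenvector A v (ev (proj_point v)) \<and> ev (proj_point v) \<noteq> 0 \<and> herm_H v = 0"
      if "v \<in> rep ` S" for v
      using that rep by (metis imageE)
  qed
qed

theorem theorem4p4:
  fixes F :: "(complex ^ ('p::finite + 'q::finite)) set \<Rightarrow> (complex ^ ('p + 'q)) set"
    and A :: "complex ^ ('p + 'q) ^ ('p + 'q)"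
  assumes "linear_self_map F"
    and "matrix_representation A F"
    and "\<not> (\<exists>L. proj_line L \<and> L \<subseteq> gen_ball_boundary \<and> L \<subseteq> fixed_points A)"
  shows "(CARD('p) \<le> CARD('q) \<longrightarrow>
            (\<exists>S. finite S \<and> card S \<ge> 2 * CARD('p) + 1 \<and> S \<subseteq> fixed_points A \<inter> gen_ball_boundary) \<longrightarrow>
            (\<exists>X. X \<in> gen_ball \<and> X \<in> fixed_points A) \<and>
            (\<exists>L. proj_line L \<and> L \<subseteq> fixed_points A)) \<and>
         (CARD('p) > CARD('q) \<longrightarrow>
            (\<exists>S. finite S \<and> card S \<ge> 2 * CARD('q) \<and> S \<subseteq> fixed_points A \<inter> gen_ball_boundary) \<longrightarrow>
            (\<exists>X. X \<in> gen_ball \<and> X \<in> fixed_points A))"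
proof -
  note pos = linear_self_map_pos[OF assms(1,2)]
  \<comment> \<open>Injectivity of \<open>proj_point\<close> guarantees that two vectors sharing an
    eigenvalue span a plane, hence a projective line. This settles both parts unless the eigenvalues
    are distinct.\<close>
  have common_eigenvalue: "(\<exists>X. X \<in> gen_ball \<and> X \<in> fixed_points A) \<and> (\<exists>L. proj_line L \<and> L \<subseteq> fixed_points A)"
    if inj: "inj_on proj_point V" "\<not> inj_on ev V"
      and V: "\<And>v. v \<in> V \<Longrightarrow> eigenvector A v (ev v) \<and> ev v \<noteq> 0 \<and> herm_H v = 0" for V ev
  proof -
    obtain v w where vw: "v \<in> V" "w \<in> V" "v \<noteq> w" "ev v = ev w"
      using inj(2) by (auto simp: inj_on_def)
    then have "proj_point v \<noteq> proj_point w"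
      using inj(1) by (metis inj_onD)
    with V[OF vw(1)] V[OF vw(2)] vw(4) show ?thesis
      by (intro equal_eigenvalues_fixed_point[OF assms(3), of v w "ev v"]) simp_all
  qed
  show ?thesis
  proof (rule conjI; intro impI)
    assume "\<exists>S. finite S \<and> card S \<ge> 2 * CARD('p) + 1 \<and> S \<subseteq> fixed_points A \<inter> gen_ball_boundary"
    then obtain S where S: "finite S" "card S \<ge> 2 * CARD('p) + 1" "S \<subseteq> fixed_points A \<inter> gen_ball_boundary"
      by blast
    obtain V ev where V: "finite V" "card V = card S" "inj_on proj_point V"
      and ev: "\<And>v. v \<in> V \<Longrightarrow> eigenvector A v (ev v) \<and> ev v \<noteq> 0 \<and> herm_H v = 0"
      using boundary_fixed_point_representatives[OF S(1,3)] by metis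
    \<comment> \<open>Distinct eigenvalues would give 2p + 1 <= |V| <= 2|T| <= 2p.\<close>
    have "\<not> inj_on ev V"
    proof
      assume inj: "inj_on ev V"
      show False
      proof (rule isotropic_half[OF pos V(1) ev inj])
        fix T :: "(complex ^ ('p + 'q)) set"
        assume "card T \<le> CARD('p)" "card V \<le> 2 * card T"
        with V(2) S(2) show False
          by simp
      qed
    qed
    then show "(\<exists>X. X \<in> gen_ball \<and> X \<in> fixed_points A) \<and> (\<exists>L. proj_line L \<and> L \<subseteq> fixed_points A)"
      by (rule common_eigenvalue[OF V(3) _ ev])
  next
    assume "\<exists>S. finite S \<and> card S \<ge> 2 * CARD('q) \<and> S \<subseteq> fixed_points A \<inter> gen_ball_boundary"
      and gt: "CARD('p) > CARD('q)"
    then obtain S where S: "finite S" "card S \<ge> 2 * CARD('q)" "S \<subseteq> fixed_points A \<inter> gen_ball_boundary"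
      by blast
    obtain V ev where V: "finite V" "card V = card S" "inj_on proj_point V"
      and ev: "\<And>v. v \<in> V \<Longrightarrow> eigenvector A v (ev v) \<and> ev v \<noteq> 0 \<and> herm_H v = 0"
      using boundary_fixed_point_representatives[OF S(1,3)] by metis
    show "\<exists>X. X \<in> gen_ball \<and> X \<in> fixed_points A"
    proof (cases "inj_on ev V")
      case False
      show ?thesis
        by (rule common_eigenvalue[OF V(3) False ev, THEN conjunct1])
    next
      case True
      show ?thesis
      proof (rule isotropic_half[OF pos V(1) ev True])
        fix T :: "(complex ^ ('p + 'q)) set"
        assume T: "T \<subseteq> V" "vec.independent T" "card T \<le> CARD('q)"
            "\<And>x y. x \<in> T \<Longrightarrow> y \<in> T \<Longrightarrow> hform x y = 0" "card V \<le> 2 * card T"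
          and dual: "\<And>t. card V = 2 * card T \<Longrightarrow> t \<in> T \<Longrightarrow>
            \<exists>s\<in>V. hform s t \<noteq> 0 \<and> (\<forall>t'\<in>V - {t}. hform s t' = 0)"
        have "finite T"
          using T(1) V(1) by (rule finite_subset)
        \<comment> \<open>The chain 2q <= |V| <= 2|T| <= 2q collapses, so this is the extremal case;
          and 2q < p + q since p > q, which leaves room for an orthogonal vector.\<close>
        have cards: "card T = CARD('q)" "card V = 2 * card T"
          using T(3,5) V(2) S(2) by linarith+
        then have "card V < CARD('p + 'q)"
          using gt by simp
        then obtain x c where x: "eigenvector A x c" "\<forall>v\<in>V. hform v x = 0"
          using orthogonal_complement_eigenvector[OF pos V(1)] ev by blast
        then have "x \<noteq> 0"
          by (auto simp: eigenvector_def)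
        then have "Re (herm_H x) > 0"
          using x(2)
          by (intro positive_on_complement[OF \<open>finite T\<close> T(2) cards(1) T(1,4) dual[OF cards(2)]]) simp_all
        \<comment> \<open>Only positivity of \<open>x\<close> rules out the eigenvalue 0: the image
          of \<open>x\<close> is again positive, hence nonzero.\<close>
        moreover from pos[OF this] have "A *v x \<noteq> 0"
          by (auto simp: herm_H_eq_hform)
        then have "c \<noteq> 0"
          using x(1) by (auto simp: eigenvector_def)
        ultimately have "proj_point x \<in> gen_ball" "proj_point x \<in> fixed_points A"
          using x(1) \<open>x \<noteq> 0\<close> by (auto simp: proj_point_in_gen_ball_iff fixed_points_def)
        then show ?thesis
          by blast
      qed
    qed
  qed
qed

end
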